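(* Let $\delta\ge0$ and let $\mu$ be an inventory-agnostic policy that offers a deterministic sequence of assortments and is locally-optimal with threshold $\delta$, that is, $\mathrm{rev}(M_{jt}(\mu,S))\le\mathrm{rev}(\mu)+\delta$ for all $j\in\mathcal J$, $t\in\mathcal T$ and $S\subseteq\mathcal N$. Let $\varphi^\mu_t=(\varphi^\mu_{1t},\dots,\varphi^\mu_{nt})$, where $\varphi^\mu_{it}=\sum_{j\in\mathcal J}\lambda_{jt}\,\phi_{ij}(S^\mu_{jt})$ is the demand probability of product $i$ at period $t$ under $\mu$. Then $(\varphi^\mu_1,\dots,\varphi^\mu_T)$ is an $\epsilon$-stationary point of $R:[0,1]^{n\times T}\to\mathbb R_+$ with respect to $\mathcal P_1\times\cdots\times\mathcal P_T$, with $\epsilon=mT\delta$.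
   Context: Model data. Products $\mathcal N=\{1,\dots,n\}$ with revenues $r_i\ge0$ and initial inventories $c_i\in\mathbb Z_+$; customer types $\mathcal J=\{1,\dots,m\}$; periods $\mathcal T=\{1,\dots,T\}$; arrival probabilities $\lambda_{jt}\ge0$ with $\sum_{j\in\mathcal J}\lambda_{jt}=1$ for each $t$; choice probabilities $\phi_{ij}(S)\ge0$ for $S\subseteq\mathcal N$, with $\sum_{i\in\mathcal N}\phi_{ij}(S)\le1$, $\phi_{ij}(S)=0$ for $i\notin S$, and (substitutability) $\phi_{ij}(S\cup\{\ell\})\le\phi_{ij}(S)$ for all $i\in S$, $\ell\notin S$. Revenue function. For each $i$, $F_i(u_1,\dots,u_T)=\mathbb E\{\min\{c_i,\sum_{t\in\mathcal T}B_{it}(u_t)\}\}$ for $(u_1,\dots,u_T)\in[0,1]^T$, where $B_{it}(u_t)$, $t\in\mathcal T$, are independent Bernoulli random variables with parameters $u_t$. For vectors $p_t=(p_{1t},\dots,p_{nt})\in[0,1]^n$, $R(p_1,\dots,p_T)=\sum_{i\in\mathcal N}r_i\,F_i(p_{i1},\dots,p_{iT})$, and $\nabla_tR=(\partial R/\partial p_{it}:i\in\mathcal N)$. Feasible sets. With $\Delta=\{\alpha\in\mathbb R_+^{2^n}:\sum_{S\subseteq\mathcal N}\alpha(S)=1\}$, $$\mathcal P_t=\Big\{p\in\mathbb R_+^n:\exists(\alpha_1,\dots,\alpha_m)\in\Delta^m\text{ with }p_i=\sum_{j\in\mathcal J}\sum_{S\subseteq\mathcal N}\lambda_{jt}\,\phi_{ij}(S)\,\alpha_j(S)\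 \ \forall i\in\mathcal N\Big\}.$$ A point $(\hat p_1,\dots,\hat p_T)\in\mathcal P_1\times\cdots\times\mathcal P_T$ is an $\epsilon$-stationary point of $R$ with respect to $\mathcal P_1\times\cdots\times\mathcal P_T$ if $\sum_{t\in\mathcal T}\langle\nabla_tR(\hat p_1,\dots,\hat p_T),q_t-\hat p_t\rangle\le\epsilon$ for all $(q_1,\dots,q_T)\in\mathcal P_1\times\cdots\times\mathcal P_T$. Policies. A deterministic inventory-agnostic policy $\mu$ fixes an assortment $S^\mu_{jt}\subseteq\mathcal N$ for each $(j,t)$, offered to a type-$j$ customer arriving at period $t$ (one customer arrives per period, of type $j$ with probability $\lambda_{jt}$, independently across periods) regardless of inventories; she chooses product $i$ with probability $\phi_{ij}(S^\mu_{jt})$, and if the chosen product is out of stock she leaves without a purchase. Its total expected revenue is $\mathrm{rev}(\mu)=R(\varphi^\mu_1,\dots,\varphi^\mu_T)$. $M_{jt}(\mu,S)$ is the policy obtained from $\mu$ by replacing $S^\mu_{jt}$ with $S$, keeping all else unchanged. *)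

theory Defs
  imports "HOL-Probability.Probability"
begin

record choice_model =
  nproducts :: nat
  ntypes :: nat
  horizon :: nat
  price :: "nat \<Rightarrow> real"
  inventory :: "nat \<Rightarrow> nat"
  arrival_prob :: "nat \<Rightarrow> nat \<Rightarrow> real"
  choice_prob :: "nat \<Rightarrow> nat \<Rightarrow> nat set \<Rightarrow> real"

text \<open>
  Index conventions: \<open>price M i\<close> is $r_i$, \<open>arrival_prob M j t\<close> is $\lambda_{jt}$,
  \<open>choice_prob M i j S\<close> is $\phi_{ij}(S)$, and an offered assortment is \<open>\<mu> j t\<close>.
  A family $(p_1,\dots,p_T)$ of vectors $p_t \in [0,1]^n$ is written \<open>p t i\<close>; its values at
  indices outside the product set or the set of periods are irrelevant.
\<close>

definition products :: "choice_model \<Rightarrow> nat set" where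
  "products M = {1..nproducts M}"

definition types :: "choice_model \<Rightarrow> nat set" where
  "types M = {1..ntypes M}"

definition periods :: "choice_model \<Rightarrow> nat set" where
  "periods M = {1..horizon M}"

definition valid_model :: "choice_model \<Rightarrow> bool" where
  "valid_model M \<longleftrightarrow>
     (\<forall>i\<in>products M. price M i \<ge> 0) \<and>
     (\<forall>j\<in>types M. \<forall>t\<in>periods M. arrival_prob M j t \<ge> 0) \<and>
     (\<forall>t\<in>periods M. (\<Sum>j\<in>types M. arrival_prob M j t) = 1) \<and>
     (\<forall>i\<in>products M. \<forall>j\<in>types M. \<forall>S. S \<subseteq> products M \<longrightarrow> choice_prob M i j S \<ge> 0) \<and>
     (\<forall>j\<in>types M. \<forall>S. S \<subseteq> products M \<longrightarrow> (\<Sum>i\<in>products M. choice_prob M i j S) \<le> 1) \<and>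
     (\<forall>i\<in>products M. \<forall>j\<in>types M. \<forall>S. S \<subseteq> products M \<longrightarrow> i \<notin> S \<longrightarrow> choice_prob M i j S = 0) \<and>
     (\<forall>j\<in>types M. \<forall>S. S \<subseteq> products M \<longrightarrow>
        (\<forall>i\<in>S. \<forall>l\<in>products M - S. choice_prob M i j (insert l S) \<le> choice_prob M i j S))"

text \<open>The \<open>B t\<close>, \<open>t \<in> periods M\<close>, are independent Bernoulli variables with parameters \<open>u t\<close>.\<close>

definition expected_sales :: "choice_model \<Rightarrow> nat \<Rightarrow> (nat \<Rightarrow> real) \<Rightarrow> real" where
  "expected_sales M i u =
     measure_pmf.expectation (Pi_pmf (periods M) False (\<lambda>t. bernoulli_pmf (u t)))
       (\<lambda>B. min (real (inventory M i)) (\<Sum>t\<in>periods M. of_bool (B t)))"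

definition revenue_fun :: "choice_model \<Rightarrow> (nat \<Rightarrow> nat \<Rightarrow> real) \<Rightarrow> real" where
  "revenue_fun M p = (\<Sum>i\<in>products M. price M i * expected_sales M i (\<lambda>t. p t i))"

text \<open>
  The revenue function lives on \<open>[0,1]\<^sup>n\<^sup>\<times>\<^sup>T\<close> only (\<open>bernoulli_pmf\<close> truncates its parameter to
  \<open>[0,1]\<close>), so each partial derivative is taken within \<open>[0,1]\<close>: at the endpoints it is the
  one-sided one.
\<close>

definition revenue_partial ::
    "choice_model \<Rightarrow> (nat \<Rightarrow> nat \<Rightarrow> real) \<Rightarrow> nat \<Rightarrow> nat \<Rightarrow> real" where
  "revenue_partial M p t i =
     vector_derivative (\<lambda>x. revenue_fun M (p(t := (p t)(i := x)))) (at (p t i) within {0..1})"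

definition assortment_simplex :: "choice_model \<Rightarrow> (nat set \<Rightarrow> real) set" where
  "assortment_simplex M =
     {\<alpha>. (\<forall>S. S \<subseteq> products M \<longrightarrow> \<alpha> S \<ge> 0) \<and> (\<Sum>S\<in>Pow (products M). \<alpha> S) = 1}"

definition feasible_demands :: "choice_model \<Rightarrow> nat \<Rightarrow> (nat \<Rightarrow> real) set" where
  "feasible_demands M t =
     {p. (\<forall>i\<in>products M. p i \<ge> 0) \<and>
         (\<exists>\<alpha>. (\<forall>j\<in>types M. \<alpha> j \<in> assortment_simplex M) \<and>
              (\<forall>i\<in>products M. p i =
                 (\<Sum>j\<in>types M. \<Sum>S\<in>Pow (products M).
                    arrival_prob M j t * choice_prob M i j S * \<alpha> j S)))}"

definition feasible_points :: "choice_model \<Rightarrow> (nat \<Rightarrow> nat \<Rightarrow> real) set" where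
  "feasible_points M = Pi (periods M) (feasible_demands M)"

definition stationary_point :: "choice_model \<Rightarrow> real \<Rightarrow> (nat \<Rightarrow> nat \<Rightarrow> real) \<Rightarrow> bool" where
  "stationary_point M \<epsilon> p \<longleftrightarrow>
     p \<in> feasible_points M \<and>
     (\<forall>q\<in>feasible_points M.
        (\<Sum>t\<in>periods M. \<Sum>i\<in>products M. revenue_partial M p t i * (q t i - p t i)) \<le> \<epsilon>)"

definition policy :: "choice_model \<Rightarrow> (nat \<Rightarrow> nat \<Rightarrow> nat set) \<Rightarrow> bool" where
  "policy M \<mu> \<longleftrightarrow> (\<forall>j\<in>types M. \<forall>t\<in>periods M. \<mu> j t \<subseteq> products M)"

definition demand_prob :: "choice_model \<Rightarrow> (nat \<Rightarrow> nat \<Rightarrow> nat set) \<Rightarrow> nat \<Rightarrow> nat \<Rightarrow> real" where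
  "demand_prob M \<mu> t i = (\<Sum>j\<in>types M. arrival_prob M j t * choice_prob M i j (\<mu> j t))"

text \<open>
  Sales process of a policy. In each period one customer arrives; \<open>None\<close> means that she chooses no
  product, \<open>Some i\<close> that she chooses product \<open>i\<close>, whether or not it is in stock.
\<close>

definition arrival_pmf :: "choice_model \<Rightarrow> nat \<Rightarrow> nat pmf" where
  "arrival_pmf M t = embed_pmf (\<lambda>j. if j \<in> types M then arrival_prob M j t else 0)"

definition choice_pmf :: "choice_model \<Rightarrow> nat \<Rightarrow> nat set \<Rightarrow> nat option pmf" where
  "choice_pmf M j S = embed_pmf (\<lambda>x. case x of
       None \<Rightarrow> 1 - (\<Sum>i\<in>products M. choice_prob M i j S)
     | Some i \<Rightarrow> if i \<in> products M then choice_prob M i j S else 0)"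

definition demand_pmf :: "choice_model \<Rightarrow> (nat \<Rightarrow> nat \<Rightarrow> nat set) \<Rightarrow> (nat \<Rightarrow> nat option) pmf" where
  "demand_pmf M \<mu> =
     Pi_pmf (periods M) None (\<lambda>t. bind_pmf (arrival_pmf M t) (\<lambda>j. choice_pmf M j (\<mu> j t)))"

text \<open>
  \<open>stock M x t i\<close> is the inventory of product \<open>i\<close> left after period \<open>t\<close>; the subtraction is the
  truncated one, i.e. a customer whose choice is out of stock changes nothing.
\<close>

primrec stock :: "choice_model \<Rightarrow> (nat \<Rightarrow> nat option) \<Rightarrow> nat \<Rightarrow> nat \<Rightarrow> nat" where
  "stock M x 0 = inventory M"
| "stock M x (Suc t) =
     (case x (Suc t) of
        None \<Rightarrow> stock M x t
      | Some i \<Rightarrow> (stock M x t)(i := stock M x t i - 1))"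

definition path_revenue :: "choice_model \<Rightarrow> (nat \<Rightarrow> nat option) \<Rightarrow> real" where
  "path_revenue M x =
     (\<Sum>t\<in>periods M. case x t of
        None \<Rightarrow> 0
      | Some i \<Rightarrow> if stock M x (t - 1) i > 0 then price M i else 0)"

definition policy_revenue :: "choice_model \<Rightarrow> (nat \<Rightarrow> nat \<Rightarrow> nat set) \<Rightarrow> real" where
  "policy_revenue M \<mu> = measure_pmf.expectation (demand_pmf M \<mu>) (path_revenue M)"

definition modify_policy ::
    "nat \<Rightarrow> nat \<Rightarrow> (nat \<Rightarrow> nat \<Rightarrow> nat set) \<Rightarrow> nat set \<Rightarrow> (nat \<Rightarrow> nat \<Rightarrow> nat set)" where
  "modify_policy j t \<mu> S = \<mu>(j := (\<mu> j)(t := S))"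

definition locally_optimal :: "choice_model \<Rightarrow> real \<Rightarrow> (nat \<Rightarrow> nat \<Rightarrow> nat set) \<Rightarrow> bool" where
  "locally_optimal M \<delta> \<mu> \<longleftrightarrow>
     (\<forall>j\<in>types M. \<forall>t\<in>periods M. \<forall>S. S \<subseteq> products M \<longrightarrow>
        policy_revenue M (modify_policy j t \<mu> S) \<le> policy_revenue M \<mu> + \<delta>)"

lemma finite_products [simp]: "finite (products M)"
  and finite_types [simp]: "finite (types M)"
  and finite_periods [simp]: "finite (periods M)"
  by (simp_all add: products_def types_def periods_def)

lemma embed_pmf_finite_support:
  fixes f :: "'a \<Rightarrow> real"
  assumes "finite A" "\<And>x. f x \<ge> 0" "\<And>x. x \<notin> A \<Longrightarrow> f x = 0" "sum f A = 1"
  shows "pmf (embed_pmf f) x = f x"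
proof (rule pmf_embed_pmf)
  have "(\<integral>\<^sup>+x. ennreal (f x) \<partial>count_space UNIV) = (\<Sum>x\<in>A. ennreal (f x))"
    by (rule nn_integral_count_space') (use assms in auto)
  also have "\<dots> = 1"
    using assms by (simp add: sum_ennreal)
  finally show "(\<integral>\<^sup>+x. ennreal (f x) \<partial>count_space UNIV) = 1" .
qed (use assms in auto)

lemma pmf_arrival:
  assumes "valid_model M" "t \<in> periods M"
  shows "pmf (arrival_pmf M t) j = (if j \<in> types M then arrival_prob M j t else 0)"
  unfolding arrival_pmf_def
  by (rule embed_pmf_finite_support[where A = "types M"])
     (use assms in \<open>auto simp: valid_model_def\<close>)

lemma pmf_choice:
  assumes "valid_model M" "j \<in> types M" "S \<subseteq> products M"
  shows "pmf (choice_pmf M j S) x = (case x of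
       None \<Rightarrow> 1 - (\<Sum>i\<in>products M. choice_prob M i j S)
     | Some i \<Rightarrow> if i \<in> products M then choice_prob M i j S else 0)"
  unfolding choice_pmf_def
proof (rule embed_pmf_finite_support[where A = "insert None (Some ` products M)"])
  show "(\<Sum>x\<in>insert None (Some ` products M). case x of
       None \<Rightarrow> 1 - (\<Sum>i\<in>products M. choice_prob M i j S)
     | Some i \<Rightarrow> if i \<in> products M then choice_prob M i j S else 0) = 1"
    by (subst sum.insert) (auto simp: sum.reindex intro!: sum.cong)
qed (use assms in \<open>auto simp: valid_model_def image_iff split: option.splits\<close>)

lemma set_pmf_arrival:
  assumes "valid_model M" "t \<in> periods M"
  shows "set_pmf (arrival_pmf M t) \<subseteq> types M"
  using pmf_arrival[OF assms] by (auto simp: set_pmf_iff split: if_splits)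

lemma set_pmf_choice:
  assumes "valid_model M" "j \<in> types M" "S \<subseteq> products M"
  shows "set_pmf (choice_pmf M j S) \<subseteq> insert None (Some ` products M)"
  using pmf_choice[OF assms] by (auto simp: set_pmf_iff split: option.splits if_splits)

lemma set_pmf_period_demand:
  assumes "valid_model M" "policy M \<mu>" "t \<in> periods M"
  shows "set_pmf (bind_pmf (arrival_pmf M t) (\<lambda>j. choice_pmf M j (\<mu> j t)))
           \<subseteq> insert None (Some ` products M)"
  using set_pmf_arrival[OF assms(1,3)] set_pmf_choice[OF assms(1)] assms(2,3)
  unfolding policy_def by (simp add: set_bind_pmf) blast

lemma pmf_period_demand:
  assumes "valid_model M" "policy M \<mu>" "t \<in> periods M" "i \<in> products M"
  shows "pmf (bind_pmf (arrival_pmf M t) (\<lambda>j. choice_pmf M j (\<mu> j t))) (Some i)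
           = demand_prob M \<mu> t i"
proof -
  have "pmf (bind_pmf (arrival_pmf M t) (\<lambda>j. choice_pmf M j (\<mu> j t))) (Some i)
      = (\<Sum>j\<in>types M. pmf (choice_pmf M j (\<mu> j t)) (Some i) * pmf (arrival_pmf M t) j)"
    unfolding pmf_bind
    by (rule integral_measure_pmf_real) (use set_pmf_arrival[OF assms(1,3)] in auto)
  also have "\<dots> = demand_prob M \<mu> t i"
    unfolding demand_prob_def
    by (rule sum.cong) (use assms in \<open>auto simp: pmf_arrival pmf_choice policy_def\<close>)
  finally show ?thesis .
qed

lemma map_period_demand:
  assumes "valid_model M" "policy M \<mu>" "t \<in> periods M" "i \<in> products M"
  shows "map_pmf (\<lambda>x. x = Some i) (bind_pmf (arrival_pmf M t) (\<lambda>j. choice_pmf M j (\<mu> j t)))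
           = bernoulli_pmf (demand_prob M \<mu> t i)" (is "map_pmf ?f ?D = _")
proof -
  have T: "pmf (map_pmf ?f ?D) True = demand_prob M \<mu> t i"
    using pmf_period_demand[OF assms]
    by (simp add: pmf_map vimage_def measure_pmf_single)
  hence "0 \<le> demand_prob M \<mu> t i" "demand_prob M \<mu> t i \<le> 1"
    by (metis pmf_nonneg, metis pmf_le_1)
  with T show ?thesis
    by (intro pmf_eqI) (metis (full_types) pmf_False_conv_True pmf_bernoulli_True)
qed

lemma stock_eq:
  "stock M x t i = inventory M i - card {s\<in>{1..t}. x s = Some i}"
proof (induction t)
  case (Suc t)
  have "{s\<in>{1..Suc t}. x s = Some i} =
      (if x (Suc t) = Some i then insert (Suc t) {s\<in>{1..t}. x s = Some i}
       else {s\<in>{1..t}. x s = Some i})"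
    by (auto simp: le_Suc_eq)
  hence "card {s\<in>{1..Suc t}. x s = Some i} =
      card {s\<in>{1..t}. x s = Some i} + of_bool (x (Suc t) = Some i)"
    by simp
  with Suc show ?case
    by (auto split: option.splits)
qed simp

lemma path_revenue_eq:
  assumes "\<And>t. t \<in> periods M \<Longrightarrow> x t \<in> insert None (Some ` products M)"
  shows "path_revenue M x = (\<Sum>i\<in>products M. price M i *
           min (real (inventory M i)) (\<Sum>t\<in>periods M. of_bool (x t = Some i)))"
proof -
  have one: "(\<Sum>t\<in>{1..k}. of_bool (x t = Some i \<and> stock M x (t - 1) i > 0)) =
      min (real (inventory M i)) (\<Sum>t\<in>{1..k}. of_bool (x t = Some i))" for k i
  proof (induction k)
    case (Suc k)
    have "(\<Sum>t\<in>{1..k}. of_bool (x t = Some i)) = real (card {s\<in>{1..k}. x s = Some i})"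
      by (simp add: of_bool_def sum.If_cases Int_def)
    with Suc show ?case
      by (auto simp: stock_eq)
  qed simp
  have "path_revenue M x = (\<Sum>t\<in>periods M. \<Sum>i\<in>products M.
          price M i * of_bool (x t = Some i \<and> stock M x (t - 1) i > 0))"
    unfolding path_revenue_def
  proof (rule sum.cong)
    fix t assume t: "t \<in> periods M"
    show "(case x t of None \<Rightarrow> 0 | Some i \<Rightarrow> if 0 < stock M x (t - 1) i then price M i else 0) =
          (\<Sum>i\<in>products M. price M i * of_bool (x t = Some i \<and> stock M x (t - 1) i > 0))"
    proof (cases "x t")
      case (Some k)
      hence "k \<in> products M" using assms[OF t] by auto
      have "(\<Sum>i\<in>products M. price M i * of_bool (x t = Some i \<and> stock M x (t - 1) i > 0)) =
         (\<Sum>i\<in>products M. if i = k then price M k * of_bool (stock M x (t - 1) k > 0) else 0)"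
        by (rule sum.cong) (auto simp: Some)
      with \<open>k \<in> products M\<close> Some show ?thesis by simp
    qed simp
  qed simp
  also have "\<dots> = (\<Sum>i\<in>products M. price M i *
      (\<Sum>t\<in>periods M. of_bool (x t = Some i \<and> stock M x (t - 1) i > 0)))"
    by (subst sum.swap) (simp only: sum_distrib_left)
  finally show ?thesis
    unfolding periods_def one .
qed

theorem policy_revenue_eq_revenue_fun:
  assumes "valid_model M" "policy M \<mu>"
  shows "policy_revenue M \<mu> = revenue_fun M (demand_prob M \<mu>)"
proof -
  let ?D = "\<lambda>t. bind_pmf (arrival_pmf M t) (\<lambda>j. choice_pmf M j (\<mu> j t))"
  let ?g = "\<lambda>i x. min (real (inventory M i)) (\<Sum>t\<in>periods M. of_bool (x t = Some i))"
  have "policy_revenue M \<mu> = measure_pmf.expectation (demand_pmf M \<mu>)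
          (\<lambda>x. \<Sum>i\<in>products M. price M i * ?g i x)"
    unfolding policy_revenue_def
  proof (intro integral_cong_AE AE_pmfI)
    fix x assume "x \<in> set_pmf (demand_pmf M \<mu>)"
    hence "x t \<in> insert None (Some ` products M)" if "t \<in> periods M" for t
      using that set_pmf_period_demand[OF assms that]
      unfolding demand_pmf_def by (auto simp: set_Pi_pmf PiE_dflt_def)
    thus "path_revenue M x = (\<Sum>i\<in>products M. price M i * ?g i x)"
      by (rule path_revenue_eq)
  qed auto
  also have "\<dots> = (\<Sum>i\<in>products M. price M i * measure_pmf.expectation (demand_pmf M \<mu>) (?g i))"
  proof (subst Bochner_Integration.integral_sum)
    show "integrable (measure_pmf (demand_pmf M \<mu>)) (\<lambda>x. price M i * ?g i x)" for i
      by (intro integrable_mult_right measure_pmf.integrable_const_bound[where B = "inventory M i"])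
         (auto simp: sum_nonneg)
  qed simp
  also have "\<dots> = revenue_fun M (demand_prob M \<mu>)"
    unfolding revenue_fun_def
  proof (rule sum.cong)
    fix i assume i: "i \<in> products M"
    have "Pi_pmf (periods M) False (\<lambda>t. bernoulli_pmf (demand_prob M \<mu> t i)) =
          Pi_pmf (periods M) False (\<lambda>t. map_pmf (\<lambda>x. x = Some i) (?D t))"
      by (rule Pi_pmf_cong) (use map_period_demand[OF assms _ i] in auto)
    also have "\<dots> = map_pmf (\<lambda>h. (\<lambda>x. x = Some i) \<circ> h) (demand_pmf M \<mu>)"
      unfolding demand_pmf_def by (rule Pi_pmf_map) auto
    finally show "price M i * measure_pmf.expectation (demand_pmf M \<mu>) (?g i) =
        price M i * expected_sales M i (\<lambda>t. demand_prob M \<mu> t i)"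
      by (simp add: expected_sales_def comp_def)
  qed simp
  finally show ?thesis .
qed

end

theory Submission
  imports Defs
begin

text \<open>
  Each \<open>F\<^sub>i\<close> is affine in every single \<open>u\<^sub>t\<close>, and distinct products contribute separate summands, so
  \<open>R\<close> is affine in the whole vector \<open>p\<^sub>t\<close> when the other periods are fixed. Hence changing the
  assortment of one pair \<open>(j, t)\<close> changes the revenue by exactly the inner product of \<open>\<nabla>\<^sub>tR\<close> with
  the change in demand. For feasible \<open>q\<close> with weights \<open>\<alpha>\<close>, the difference of \<open>q\<^sub>t\<close> and the
  demand vector of \<open>\<mu>\<close> is the \<open>\<alpha>\<^sub>j(S)\<close>-weighted sum of these changes over \<open>j\<close> and \<open>S\<close>; as the
  weights of each \<open>j\<close> sum to \<open>1\<close>, every pair \<open>(j, t)\<close> contributes at most \<open>\<delta>\<close>.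
\<close>

text \<open>The slope of \<open>F\<^sub>i\<close> in \<open>u\<^sub>t\<close>, written as the
  difference of the values at the endpoints of \<open>[0,1]\<close>. It does not depend on
  \<open>u t\<close> itself.\<close>

definition sales_slope :: "choice_model \<Rightarrow> nat \<Rightarrow> (nat \<Rightarrow> real) \<Rightarrow> nat \<Rightarrow> real" where
  "sales_slope M i u t = expected_sales M i (u(t := 1)) - expected_sales M i (u(t := 0))"

text \<open>Condition on the Bernoulli variable of period \<open>t\<close>. By independence the law
  of the other periods does not involve \<open>x\<close>, so the expectation is a mixture of two
  values with weights \<open>x\<close> and \<open>1 - x\<close>.\<close>

lemma expected_sales_convex_comb:
  assumes t: "t \<in> periods M" and x: "0 \<le> x" "x \<le> 1"
  shows "expected_sales M i (u(t := x)) =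
    x * expected_sales M i (u(t := 1)) + (1 - x) * expected_sales M i (u(t := 0))"
proof -
  let ?f = "\<lambda>B. min (real (inventory M i)) (\<Sum>s\<in>periods M. of_bool (B s))"
  define A where "A = periods M - {t}"
  have A: "finite A" "t \<notin> A" "periods M = insert t A"
    using t by (auto simp: A_def)
  \<comment> \<open>\<open>Q b\<close> is the law of all Bernoulli variables given that the one of
    period \<open>t\<close> equals \<open>b\<close>.\<close>
  define Q where
    "Q b = map_pmf (\<lambda>g. g(t := b)) (Pi_pmf A False (\<lambda>s. bernoulli_pmf (u s)))" for b
  have fin: "finite (set_pmf (Q b))" for b
    unfolding Q_def using A by (auto simp: set_Pi_pmf intro!: finite_imageI finite_PiE_dflt)
  have cond: "expected_sales M i (u(t := y)) =
      y * measure_pmf.expectation (Q True) ?f + (1 - y) * measure_pmf.expectation (Q False) ?f"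
    if y: "0 \<le> y" "y \<le> 1" for y
  proof -
    have "Pi_pmf A False (\<lambda>s. bernoulli_pmf ((u(t := y)) s)) =
        Pi_pmf A False (\<lambda>s. bernoulli_pmf (u s))"
      by (rule Pi_pmf_cong) (use A in auto)
    hence "Pi_pmf (periods M) False (\<lambda>s. bernoulli_pmf ((u(t := y)) s)) =
        bind_pmf (bernoulli_pmf y) Q"
      unfolding A(3) Q_def map_pmf_def Pi_pmf_insert'[OF A(1,2)]
      by (simp del: fun_upd_apply add: fun_upd_same)
    moreover have "measure_pmf.expectation (bind_pmf (bernoulli_pmf y) Q) ?f =
        (\<Sum>b\<in>UNIV. pmf (bernoulli_pmf y) b *\<^sub>R measure_pmf.expectation (Q b) ?f)"
      by (rule pmf_expectation_bind) (use fin in auto)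
    ultimately show ?thesis
      using y by (simp add: expected_sales_def UNIV_bool)
  qed
  \<comment> \<open>The cases \<open>y = 0\<close> and \<open>y = 1\<close> identify the two
    conditional expectations with the endpoint values.\<close>
  from cond[OF x] cond[of 0] cond[of 1] show ?thesis by simp
qed

text \<open>The same affinity, expanded around the current value \<open>u t\<close>. Both
  \<open>u t\<close> and \<open>x\<close> are kept in \<open>[0,1]\<close>, where
  \<open>bernoulli_pmf\<close> does not truncate.\<close>

lemma expected_sales_update:
  assumes "t \<in> periods M" "0 \<le> u t" "u t \<le> 1" "0 \<le> x" "x \<le> 1"
  shows "expected_sales M i (u(t := x)) = expected_sales M i u + sales_slope M i u t * (x - u t)"
proof -
  have "expected_sales M i u =
      u t * expected_sales M i (u(t := 1)) + (1 - u t) * expected_sales M i (u(t := 0))"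
    using expected_sales_convex_comb[OF assms(1-3), where u = u] by simp
  thus ?thesis
    unfolding expected_sales_convex_comb[OF assms(1,4,5)] sales_slope_def
    by (simp add: algebra_simps)
qed

text \<open>The expansion is exact even when all coordinates of \<open>p t\<close> move at once:
  product \<open>i\<close> sees only its own coordinate, so no cross terms arise.\<close>

lemma revenue_fun_update:
  assumes "t \<in> periods M"
    and "\<And>i. i \<in> products M \<Longrightarrow> 0 \<le> p t i \<and> p t i \<le> 1"
    and "\<And>i. i \<in> products M \<Longrightarrow> 0 \<le> v i \<and> v i \<le> 1"
  shows "revenue_fun M (p(t := v)) = revenue_fun M p +
    (\<Sum>i\<in>products M. price M i * sales_slope M i (\<lambda>s. p s i) t * (v i - p t i))"
proof -
  have "(\<lambda>s. (p(t := v)) s i) = (\<lambda>s. p s i)(t := v i)" for i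
    by auto
  thus ?thesis
    unfolding revenue_fun_def sum.distrib[symmetric]
    using assms by (intro sum.cong) (simp_all add: expected_sales_update algebra_simps)
qed

text \<open>Moving one coordinate within \<open>[0,1]\<close> gives an affine function, so the
  derivative within this interval is its slope, also at the endpoints.\<close>

lemma revenue_partial_eq:
  assumes t: "t \<in> periods M" and i: "i \<in> products M"
    and p: "\<And>k. k \<in> products M \<Longrightarrow> 0 \<le> p t k \<and> p t k \<le> 1"
  shows "revenue_partial M p t i = price M i * sales_slope M i (\<lambda>s. p s i) t"
proof -
  let ?d = "price M i * sales_slope M i (\<lambda>s. p s i) t"
  have eq: "revenue_fun M (p(t := (p t)(i := x))) = revenue_fun M p + ?d * (x - p t i)"
    if "x \<in> {0..1}" for x
  proof -
    have "revenue_fun M (p(t := (p t)(i := x))) = revenue_fun M p +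
        (\<Sum>k\<in>products M. price M k * sales_slope M k (\<lambda>s. p s k) t *
           (((p t)(i := x)) k - p t k))"
      by (rule revenue_fun_update) (use t p that in auto)
    also have "(\<Sum>k\<in>products M. price M k * sales_slope M k (\<lambda>s. p s k) t *
        (((p t)(i := x)) k - p t k)) = (\<Sum>k\<in>products M. if k = i then ?d * (x - p t i) else 0)"
      by (rule sum.cong) auto
    finally show ?thesis using i by (simp del: fun_upd_apply)
  qed
  have mem: "p t i \<in> {0..1}" using p[OF i] by simp
  have "((\<lambda>x. revenue_fun M p + ?d * (x - p t i)) has_vector_derivative ?d)
      (at (p t i) within {0..1})"
    by (auto intro!: derivative_eq_intros simp: has_real_derivative_iff_has_vector_derivative[symmetric])
  hence "((\<lambda>x. revenue_fun M (p(t := (p t)(i := x)))) has_vector_derivative ?d)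
      (at (p t i) within {0..1})"
    by (rule has_vector_derivative_transform[OF mem, rotated]) (use eq in auto)
  thus ?thesis
    unfolding revenue_partial_def using mem
    by (intro vector_derivative_within_closed_interval) auto
qed

lemma demand_prob_bounds:
  assumes "valid_model M" "policy M \<mu>" "t \<in> periods M" "i \<in> products M"
  shows "0 \<le> demand_prob M \<mu> t i \<and> demand_prob M \<mu> t i \<le> 1"
  using pmf_period_demand[OF assms] by (metis pmf_nonneg pmf_le_1)

lemma demand_prob_feasible:
  assumes "valid_model M" "policy M \<mu>"
  shows "demand_prob M \<mu> \<in> feasible_points M"
  unfolding feasible_points_def
proof (rule Pi_I)
  fix t assume t: "t \<in> periods M"
  \<comment> \<open>The weights are the point masses at the assortments that \<open>\<mu>\<close>
    offers.\<close>
  let ?\<alpha> = "\<lambda>j S. if S = \<mu> j t then 1 else 0 :: real"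
  have \<mu>: "\<mu> j t \<in> Pow (products M)" if "j \<in> types M" for j
    using assms(2) t that by (auto simp: policy_def)
  have fin: "finite (Pow (products M))" by simp
  have "?\<alpha> j \<in> assortment_simplex M" if "j \<in> types M" for j
    using \<mu>[OF that] fin by (simp add: assortment_simplex_def)
  moreover have "demand_prob M \<mu> t i =
      (\<Sum>j\<in>types M. \<Sum>S\<in>Pow (products M). arrival_prob M j t * choice_prob M i j S * ?\<alpha> j S)" for i
    unfolding demand_prob_def
    using \<mu> fin by (intro sum.cong) (simp_all add: if_distrib[where f = "(*) _"] cong: if_cong)
  ultimately show "demand_prob M \<mu> t \<in> feasible_demands M t"
    using demand_prob_bounds[OF assms t] unfolding feasible_demands_def
    by (intro CollectI conjI exI[of _ ?\<alpha>]) auto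
qed

lemma policy_modify_policy:
  "policy M \<mu> \<Longrightarrow> S \<subseteq> products M \<Longrightarrow> policy M (modify_policy j t \<mu> S)"
  by (auto simp: policy_def modify_policy_def)

text \<open>Stated as an update of the whole demand array at period \<open>t\<close>, the form to
  which \<open>revenue_fun_update\<close> applies.\<close>

lemma demand_prob_modify_policy:
  assumes "j \<in> types M"
  shows "demand_prob M (modify_policy j t \<mu> S) = (demand_prob M \<mu>)(t := \<lambda>i.
    demand_prob M \<mu> t i + arrival_prob M j t * (choice_prob M i j S - choice_prob M i j (\<mu> j t)))"
proof (intro ext)
  fix s i
  show "demand_prob M (modify_policy j t \<mu> S) s i = ((demand_prob M \<mu>)(t := \<lambda>i.
    demand_prob M \<mu> t i + arrival_prob M j t *
      (choice_prob M i j S - choice_prob M i j (\<mu> j t)))) s i"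
  proof (cases "s = t")
    case True
    have split: "demand_prob M \<nu> t i = arrival_prob M j t * choice_prob M i j (\<nu> j t) +
        (\<Sum>k\<in>types M - {j}. arrival_prob M k t * choice_prob M i k (\<nu> k t))" for \<nu>
      unfolding demand_prob_def using assms by (simp add: sum.remove)
    have "(\<Sum>k\<in>types M - {j}. arrival_prob M k t * choice_prob M i k (modify_policy j t \<mu> S k t)) =
        (\<Sum>k\<in>types M - {j}. arrival_prob M k t * choice_prob M i k (\<mu> k t))"
      by (rule sum.cong) (auto simp: modify_policy_def)
    hence "demand_prob M (modify_policy j t \<mu> S) t i = demand_prob M \<mu> t i +
        arrival_prob M j t * (choice_prob M i j (modify_policy j t \<mu> S j t) - choice_prob M i j (\<mu> j t))"
      unfolding split by (simp add: algebra_simps)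
    with True show ?thesis
      by (simp add: modify_policy_def)
  next
    case False
    thus ?thesis by (auto simp: demand_prob_def modify_policy_def intro!: sum.cong)
  qed
qed

lemma policy_revenue_modify_policy:
  assumes "valid_model M" "policy M \<mu>" "j \<in> types M" "t \<in> periods M" "S \<subseteq> products M"
  shows "policy_revenue M (modify_policy j t \<mu> S) = policy_revenue M \<mu> +
    (\<Sum>i\<in>products M. revenue_partial M (demand_prob M \<mu>) t i *
       (arrival_prob M j t * (choice_prob M i j S - choice_prob M i j (\<mu> j t))))"
proof -
  let ?p = "demand_prob M \<mu>"
  let ?v = "\<lambda>i. ?p t i + arrival_prob M j t * (choice_prob M i j S - choice_prob M i j (\<mu> j t))"
  note pol = policy_modify_policy[OF assms(2,5), of j t]
  note b = demand_prob_bounds[OF assms(1,2,4)]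
  \<comment> \<open>The shifted vector is the demand vector of the modified policy, hence consists
    of probabilities.\<close>
  have v: "0 \<le> ?v i \<and> ?v i \<le> 1" if "i \<in> products M" for i
    using demand_prob_bounds[OF assms(1) pol assms(4) that]
    by (simp add: demand_prob_modify_policy[OF assms(3)])
  have "policy_revenue M (modify_policy j t \<mu> S) = revenue_fun M (?p(t := ?v))"
    using policy_revenue_eq_revenue_fun[OF assms(1) pol]
    by (simp add: demand_prob_modify_policy[OF assms(3)])
  also have "\<dots> = revenue_fun M ?p +
      (\<Sum>i\<in>products M. price M i * sales_slope M i (\<lambda>s. ?p s i) t * (?v i - ?p t i))"
    by (rule revenue_fun_update[where p = ?p and v = ?v, OF assms(4) b v])
  finally show ?thesis
    using policy_revenue_eq_revenue_fun[OF assms(1,2)] revenue_partial_eq[where p = ?p, OF assms(4) _ b]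
    by simp
qed

text \<open>Passing to \<open>q\<close> may alter the assortments of all types at once, while local
  optimality controls one type at a time. Linearity of the inner product in \<open>q\<close>
  decouples the types.\<close>

lemma feasible_gradient_le:
  assumes M: "valid_model M" and pol: "policy M \<mu>" and opt: "locally_optimal M \<delta> \<mu>"
    and t: "t \<in> periods M" and q: "q \<in> feasible_demands M t"
  shows "(\<Sum>i\<in>products M. revenue_partial M (demand_prob M \<mu>) t i * (q i - demand_prob M \<mu> t i))
    \<le> real (ntypes M) * \<delta>"
proof -
  let ?p = "demand_prob M \<mu>"
  let ?g = "revenue_partial M ?p t"
  let ?d = "\<lambda>i j S. arrival_prob M j t * (choice_prob M i j S - choice_prob M i j (\<mu> j t))"
  obtain \<alpha> where \<alpha>: "\<And>j. j \<in> types M \<Longrightarrow> \<alpha> j \<in> assortment_simplex M"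
    and q_eq: "\<And>i. i \<in> products M \<Longrightarrow> q i = (\<Sum>j\<in>types M. \<Sum>S\<in>Pow (products M).
      arrival_prob M j t * choice_prob M i j S * \<alpha> j S)"
    using q by (auto simp: feasible_demands_def)
  have \<alpha>_sum: "(\<Sum>S\<in>Pow (products M). \<alpha> j S) = 1" if "j \<in> types M" for j
    using \<alpha>[OF that] by (simp add: assortment_simplex_def)
  have diff: "q i - ?p t i = (\<Sum>j\<in>types M. \<Sum>S\<in>Pow (products M). \<alpha> j S * ?d i j S)"
    if i: "i \<in> products M" for i
  proof -
    \<comment> \<open>Inserting the total weight \<open>1\<close> of each \<open>\<alpha> j\<close>
      puts the demand of \<open>\<mu>\<close> under the same sums as \<open>q\<close>.\<close>
    have "?p t i = (\<Sum>j\<in>types M. (\<Sum>S\<in>Pow (products M). \<alpha> j S) *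
        (arrival_prob M j t * choice_prob M i j (\<mu> j t)))"
      using \<alpha>_sum by (simp add: demand_prob_def)
    also have "\<dots> = (\<Sum>j\<in>types M. \<Sum>S\<in>Pow (products M).
        \<alpha> j S * (arrival_prob M j t * choice_prob M i j (\<mu> j t)))"
      by (simp only: sum_distrib_right)
    finally show ?thesis
      by (simp add: q_eq[OF i] sum_subtractf[symmetric] algebra_simps)
  qed
  have gain: "(\<Sum>i\<in>products M. ?g i * ?d i j S) \<le> \<delta>"
    if "j \<in> types M" "S \<subseteq> products M" for j S
  proof -
    have "policy_revenue M (modify_policy j t \<mu> S) \<le> policy_revenue M \<mu> + \<delta>"
      using opt that t by (simp add: locally_optimal_def)
    thus ?thesis
      unfolding policy_revenue_modify_policy[OF M pol that(1) t that(2)] by simp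
  qed
  have "(\<Sum>i\<in>products M. ?g i * (q i - ?p t i)) =
      (\<Sum>i\<in>products M. \<Sum>j\<in>types M. \<Sum>S\<in>Pow (products M). \<alpha> j S * (?g i * ?d i j S))"
    by (rule sum.cong) (simp_all add: diff sum_distrib_left mult.left_commute)
  also have "\<dots> = (\<Sum>j\<in>types M. \<Sum>S\<in>Pow (products M). \<Sum>i\<in>products M. \<alpha> j S * (?g i * ?d i j S))"
    by (subst sum.swap, rule sum.cong[OF refl], rule sum.swap)
  also have "\<dots> = (\<Sum>j\<in>types M. \<Sum>S\<in>Pow (products M). \<alpha> j S * (\<Sum>i\<in>products M. ?g i * ?d i j S))"
    by (simp only: sum_distrib_left)
  also have "\<dots> \<le> (\<Sum>j\<in>types M. \<Sum>S\<in>Pow (products M). \<alpha> j S * \<delta>)"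
    using \<alpha> gain by (intro sum_mono mult_left_mono) (auto simp: assortment_simplex_def)
  also have "\<dots> = (\<Sum>j\<in>types M. \<delta>)"
    using \<alpha>_sum by (simp add: sum_distrib_right[symmetric])
  also have "\<dots> = real (ntypes M) * \<delta>"
    by (simp add: types_def)
  finally show ?thesis .
qed

theorem lemma4p6:
  fixes M :: choice_model and \<mu> :: "nat \<Rightarrow> nat \<Rightarrow> nat set" and \<delta> :: real
  assumes "valid_model M"
    and "\<delta> \<ge> 0"
    and "policy M \<mu>"
    and "locally_optimal M \<delta> \<mu>"
  shows "stationary_point M (real (ntypes M) * real (horizon M) * \<delta>) (demand_prob M \<mu>)"
  unfolding stationary_point_def
proof (intro conjI ballI)
  show "demand_prob M \<mu> \<in> feasible_points M"
    using assms by (intro demand_prob_feasible)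
next
  fix q assume "q \<in> feasible_points M"
  hence "q t \<in> feasible_demands M t" if "t \<in> periods M" for t
    using that by (auto simp: feasible_points_def)
  \<comment> \<open>The gradient stays fixed at the demand of \<open>\<mu>\<close>, so the periods
    separate and each one is bounded on its own.\<close>
  hence "(\<Sum>t\<in>periods M. \<Sum>i\<in>products M.
      revenue_partial M (demand_prob M \<mu>) t i * (q t i - demand_prob M \<mu> t i))
    \<le> (\<Sum>t\<in>periods M. real (ntypes M) * \<delta>)"
    using assms by (intro sum_mono feasible_gradient_le)
  thus "(\<Sum>t\<in>periods M. \<Sum>i\<in>products M.
      revenue_partial M (demand_prob M \<mu>) t i * (q t i - demand_prob M \<mu> t i))
    \<le> real (ntypes M) * real (horizon M) * \<delta>"
    by (simp add: periods_def mult_ac)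
qed

end
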